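(* Let $k\ge 2$, $n\ge 2k-1$, and $0\le u\le k-2$ be fixed integers, and let $q\ge n$ be a prime power. There exists a set $\mathcal{M}\subseteq\mathcal{M}_q(k,n)$ such that $\dim(\mathcal{C}\cap\mathcal{D})\le u$ for every two distinct $\mathcal{C},\mathcal{D}\in\mathcal{M}$ and $$|\mathcal{M}|\ \ge\ q^{(u+1)(n-2k+u+1)}(1+o(1)),$$ where $o(1)\to0$ as $q\to\infty$.
   Context: $\mathcal{M}_q(k,n)$ denotes the set of all $k$-dimensional subspaces of $\mathbb{F}_q^n$ that are MDS codes, i.e. whose minimum Hamming distance equals $n-k+1$. Asymptotics are taken as $q\to\infty$ through prime powers with $k,n,u$ fixed. *)

theory Defs
  imports Complex_Main "HOL-Algebra.Embedded_Algebras" "HOL-Number_Theory.Prime_Powers"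
begin

text \<open>
  The space of vectors \<open>F^n\<close>, with coordinates indexed by \<open>{..<n}\<close>. It carries the componentwise
  ring structure so that the linear algebra of \<^theory>\<open>HOL-Algebra.Embedded_Algebras\<close> applies: that
  theory measures subspaces of a ring over a subfield of the ring, and scalar multiplication by
  \<open>a\<close> on \<open>F^n\<close> is multiplication by the constant vector \<open>(a, ..., a)\<close>.
\<close>

definition coord_space :: "('a, 'b) ring_scheme \<Rightarrow> nat \<Rightarrow> (nat \<Rightarrow> 'a) ring" where
  "coord_space F n =
     \<lparr> carrier = {..<n} \<rightarrow>\<^sub>E carrier F,
       monoid.mult = (\<lambda>x y. \<lambda>i\<in>{..<n}. x i \<otimes>\<^bsub>F\<^esub> y i),
       one = (\<lambda>i\<in>{..<n}. \<one>\<^bsub>F\<^esub>),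
       zero = (\<lambda>i\<in>{..<n}. \<zero>\<^bsub>F\<^esub>),
       add = (\<lambda>x y. \<lambda>i\<in>{..<n}. x i \<oplus>\<^bsub>F\<^esub> y i) \<rparr>"

definition scalars :: "('a, 'b) ring_scheme \<Rightarrow> nat \<Rightarrow> (nat \<Rightarrow> 'a) set" where
  "scalars F n = (\<lambda>a. \<lambda>i\<in>{..<n}. a) ` carrier F"

text \<open>
  Despite its name, the library locale \<^locale>\<open>subalgebra\<close> only asks for an additive subgroup
  closed under multiplication by scalars, i.e. for a linear subspace.
\<close>

definition linear_code :: "('a, 'b) ring_scheme \<Rightarrow> nat \<Rightarrow> (nat \<Rightarrow> 'a) set \<Rightarrow> bool" where
  "linear_code F n C \<longleftrightarrow> subalgebra (scalars F n) C (coord_space F n)"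

definition code_dim :: "('a, 'b) ring_scheme \<Rightarrow> nat \<Rightarrow> (nat \<Rightarrow> 'a) set \<Rightarrow> nat" where
  "code_dim F n C = ring.dim (coord_space F n) (scalars F n) C"

definition hamming_dist :: "nat \<Rightarrow> (nat \<Rightarrow> 'a) \<Rightarrow> (nat \<Rightarrow> 'a) \<Rightarrow> nat" where
  "hamming_dist n x y = card {i. i < n \<and> x i \<noteq> y i}"

text \<open>Only meaningful for codes with at least two codewords.\<close>

definition min_dist :: "nat \<Rightarrow> (nat \<Rightarrow> 'a) set \<Rightarrow> nat" where
  "min_dist n C = Min {hamming_dist n x y | x y. x \<in> C \<and> y \<in> C \<and> x \<noteq> y}"

text \<open>The subtraction is not truncated when \<open>k \<le> n\<close>.\<close>

definition mds_codes :: "('a, 'b) ring_scheme \<Rightarrow> nat \<Rightarrow> nat \<Rightarrow> (nat \<Rightarrow> 'a) set set" where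
  "mds_codes F k n =
     {C. linear_code F n C \<and> code_dim F n C = k \<and> min_dist n C = n - k + 1}"

lemma cring_coord_space:
  assumes "cring F"
  shows "cring (coord_space F n)"
proof -
  interpret F: cring F by fact
  have mem: "x i \<in> carrier F" if "x \<in> carrier (coord_space F n)" "i < n" for x i
    using that by (auto simp: coord_space_def)
  have eqI: "x = y" if "x \<in> carrier (coord_space F n)" "y \<in> carrier (coord_space F n)"
    "\<And>i. i < n \<Longrightarrow> x i = y i" for x y
    using that by (auto simp: coord_space_def intro: PiE_ext)
  have closed: "x \<oplus>\<^bsub>coord_space F n\<^esub> y \<in> carrier (coord_space F n)"
    "x \<otimes>\<^bsub>coord_space F n\<^esub> y \<in> carrier (coord_space F n)"
    if "x \<in> carrier (coord_space F n)" "y \<in> carrier (coord_space F n)" for x y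
    using mem[OF that(1)] mem[OF that(2)] by (simp_all add: coord_space_def)
  have units: "\<zero>\<^bsub>coord_space F n\<^esub> \<in> carrier (coord_space F n)"
    "\<one>\<^bsub>coord_space F n\<^esub> \<in> carrier (coord_space F n)"
    by (simp_all add: coord_space_def)
  have nth: "(x \<oplus>\<^bsub>coord_space F n\<^esub> y) i = x i \<oplus>\<^bsub>F\<^esub> y i"
    "(x \<otimes>\<^bsub>coord_space F n\<^esub> y) i = x i \<otimes>\<^bsub>F\<^esub> y i"
    "\<zero>\<^bsub>coord_space F n\<^esub> i = \<zero>\<^bsub>F\<^esub>" "\<one>\<^bsub>coord_space F n\<^esub> i = \<one>\<^bsub>F\<^esub>"
    if "i < n" for x y i
    using that by (simp_all add: coord_space_def)
  show ?thesis
  proof (intro cringI abelian_groupI comm_monoidI)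
    fix x assume x: "x \<in> carrier (coord_space F n)"
    have y: "(\<lambda>i\<in>{..<n}. \<ominus>\<^bsub>F\<^esub> x i) \<in> carrier (coord_space F n)"
      using mem[OF x] by (simp add: coord_space_def)
    then show "\<exists>y\<in>carrier (coord_space F n).
            y \<oplus>\<^bsub>coord_space F n\<^esub> x = \<zero>\<^bsub>coord_space F n\<^esub>"
      by (rule bexI[rotated]) (rule eqI, simp_all add: x y closed units nth mem F.l_neg)
  qed ((rule eqI)?, simp_all add: closed units nth mem F.a_ac F.m_ac F.l_distr F.r_distr)+
qed

lemma subfield_scalars:
  assumes "field F" and "n > 0"
  shows "subfield (scalars F n) (coord_space F n)"
proof -
  interpret F: field F by fact
  interpret V: cring "coord_space F n" by (rule cring_coord_space) (rule F.is_cring)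
  have cR: "scalars F n \<subseteq> carrier (coord_space F n)"
    by (auto simp: scalars_def coord_space_def split: if_splits)
  have one: "\<one>\<^bsub>coord_space F n\<^esub> \<in> scalars F n"
    by (auto simp: scalars_def coord_space_def)
  have const: "(\<lambda>i\<in>{..<n}. a) \<in> scalars F n" if "a \<in> carrier F" for a
    using that by (auto simp: scalars_def)
  have sr: "subring (scalars F n) (coord_space F n)"
  proof (rule V.subringI[OF cR one])
    fix h assume "h \<in> scalars F n"
    then obtain a where a: "a \<in> carrier F" "h = (\<lambda>i\<in>{..<n}. a)" by (auto simp: scalars_def)
    have "(\<lambda>i\<in>{..<n}. \<ominus>\<^bsub>F\<^esub> a) \<oplus>\<^bsub>coord_space F n\<^esub> h = \<zero>\<^bsub>coord_space F n\<^esub>"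
      using a by (auto simp: coord_space_def F.l_neg intro!: restrict_ext)
    then have "\<ominus>\<^bsub>coord_space F n\<^esub> h = (\<lambda>i\<in>{..<n}. \<ominus>\<^bsub>F\<^esub> a)"
      using a cR const by (intro V.minus_equality) auto
    then show "\<ominus>\<^bsub>coord_space F n\<^esub> h \<in> scalars F n"
      using a const by simp
  next
    fix h1 h2 assume "h1 \<in> scalars F n" "h2 \<in> scalars F n"
    then obtain a b where ab: "a \<in> carrier F" "b \<in> carrier F"
      "h1 = (\<lambda>i\<in>{..<n}. a)" "h2 = (\<lambda>i\<in>{..<n}. b)" by (auto simp: scalars_def)
    have "h1 \<otimes>\<^bsub>coord_space F n\<^esub> h2 = (\<lambda>i\<in>{..<n}. a \<otimes>\<^bsub>F\<^esub> b)"
         "h1 \<oplus>\<^bsub>coord_space F n\<^esub> h2 = (\<lambda>i\<in>{..<n}. a \<oplus>\<^bsub>F\<^esub> b)"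
      using ab by (auto simp: coord_space_def intro!: restrict_ext)
    then show "h1 \<otimes>\<^bsub>coord_space F n\<^esub> h2 \<in> scalars F n"
      "h1 \<oplus>\<^bsub>coord_space F n\<^esub> h2 \<in> scalars F n"
      using ab const by simp_all
  qed
  show ?thesis
  proof (rule V.subfieldI)
    show "subcring (scalars F n) (coord_space F n)"
      using sr cR by (intro V.subcringI) (auto intro: V.m_comm)
    show "Units (coord_space F n\<lparr>carrier := scalars F n\<rparr>) =
            scalars F n - {\<zero>\<^bsub>coord_space F n\<^esub>}" (is "?U = ?S")
    proof
      show "?U \<subseteq> ?S"
      proof
        fix h assume h: "h \<in> ?U"
        then obtain g where g: "h \<in> scalars F n" "g \<in> scalars F n"
          "g \<otimes>\<^bsub>coord_space F n\<^esub> h = \<one>\<^bsub>coord_space F n\<^esub>"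
          by (auto simp: Units_def)
        have "\<one>\<^bsub>coord_space F n\<^esub> 0 \<noteq> \<zero>\<^bsub>coord_space F n\<^esub> 0"
          using \<open>n > 0\<close> F.one_not_zero by (simp add: coord_space_def)
        then have "\<one>\<^bsub>coord_space F n\<^esub> \<noteq> \<zero>\<^bsub>coord_space F n\<^esub>" by metis
        with g cR V.r_null show "h \<in> ?S" by fastforce
      qed
      show "?S \<subseteq> ?U"
      proof
        fix h assume h: "h \<in> ?S"
        then obtain a where a: "a \<in> carrier F" "h = (\<lambda>i\<in>{..<n}. a)" "a \<noteq> \<zero>\<^bsub>F\<^esub>"
          by (auto simp: scalars_def coord_space_def)
        have i: "inv\<^bsub>F\<^esub> a \<in> carrier F" "a \<otimes>\<^bsub>F\<^esub> inv\<^bsub>F\<^esub> a = \<one>\<^bsub>F\<^esub>" "inv\<^bsub>F\<^esub> a \<otimes>\<^bsub>F\<^esub> a = \<one>\<^bsub>F\<^esub>"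
          using a F.field_Units by auto
        have "h \<otimes>\<^bsub>coord_space F n\<^esub> (\<lambda>i\<in>{..<n}. inv\<^bsub>F\<^esub> a) = \<one>\<^bsub>coord_space F n\<^esub>"
             "(\<lambda>i\<in>{..<n}. inv\<^bsub>F\<^esub> a) \<otimes>\<^bsub>coord_space F n\<^esub> h = \<one>\<^bsub>coord_space F n\<^esub>"
          using a i by (auto simp: coord_space_def intro!: restrict_ext)
        then show "h \<in> ?U"
          using h const[OF i(1)] by (auto simp: Units_def)
      qed
    qed
  qed
qed

end

theory Submission
  imports Defs "HOL-Algebra.Multiplicative_Group"
begin

text \<open>
  Put \<open>m = n - k\<close>. A \<open>k \<times> m\<close> matrix \<open>A\<close> over \<open>F\<close> gives the systematic code
  \<open>C\<^sub>A = {(x, xA) | x \<in> F\<^sup>k}\<close>, and \<open>C\<^sub>A \<inter> C\<^sub>B\<close> is isomorphic to the left kernel of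
  \<open>A - B\<close>. Hence it suffices to have many matrices whose pairwise differences have rank at least
  \<open>k - u\<close> and whose systematic codes are MDS. Two facts achieve both at once.

  First, there is a linear space \<open>G\<close> of \<open>k \<times> m\<close> matrices of dimension \<open>(u + 1)(m - k + u + 1)\<close>,
  which is the exponent wanted, all of whose nonzero members have rank at least \<open>k - u\<close>: fill
  every diagonal with a word of a Reed-Solomon code of minimum distance \<open>k - u\<close>
  (\<open>diagonal_matrix\<close>). A nonzero member has a first nonzero diagonal, with at least \<open>k - u\<close>
  nonzero entries; all diagonals before it vanish, so these entries are the pivots of a triangular
  system, which forces the rank (\<open>diagonal_matrix_kernel\<close>). A diagonal of length \<open>l\<close> leaves
  \<open>l - (k - u) + 1\<close> free coefficients, and these are as many as the entries of the corresponding
  diagonal of a \<open>(u + 1) \<times> (m - k + u + 1)\<close> matrix, which gives the dimension.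

  Second, all but a fraction of at most \<open>k 2\<^sup>n / q\<close> of all matrices give MDS codes
  (\<open>card_not_mds_matrix\<close>). If \<open>C\<^sub>A\<close> is not MDS, some nonzero word vanishes on a set \<open>T\<close> of
  \<open>k\<close> positions. For fixed \<open>T\<close>, and after scaling one coordinate of \<open>x\<close> to \<open>1\<close>, the
  vanishing conditions determine one coordinate or matrix entry each, so that the pairs \<open>(x, A)\<close>
  lose one degree of freedom against the matrices.

  Averaging over all translates of \<open>G\<close> then yields a matrix \<open>B\<close> such that the proportion of non-MDS
  matrices in \<open>B + G\<close> is no larger than it is among all matrices. Translation does not change
  differences, so the MDS members of \<open>B + G\<close> form the required set.

  Dimensions are read off from cardinalities throughout: a code of dimension \<open>d\<close> has \<open>q\<^sup>d\<close> words.
\<close>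

section \<open>Dimension and cardinality\<close>

text \<open>
  Adjoining a vector \<open>v\<close> outside \<open>E\<close> multiplies the cardinality by \<open>card K\<close>, because the
  decomposition \<open>a v + w\<close> with \<open>a \<in> K\<close> and \<open>w \<in> E\<close> is unique.
\<close>

lemma (in ring) card_eq_card_power_dimension:
  assumes K: "subfield K R" and fin: "finite K"
  shows "dimension n K E \<Longrightarrow> finite E \<and> card E = card K ^ n"
proof (induction n arbitrary: E)
  case 0
  then show ?case using dimension_zero[OF K, of E] by auto
next
  case (Suc n)
  then obtain v E' where v: "v \<in> carrier R" "v \<notin> E'" and E': "dimension n K E'"
    and E: "E = line_extension K v E'"
    using dimension_backwards[OF K] by blast
  note E'_props = space_subgroup_props[OF K E']
  have Kc: "K \<subseteq> carrier R" by (rule subring_props(1)[OF K])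
  have Ksub: "a \<ominus> b \<in> K" if "a \<in> K" "b \<in> K" for a b
    using that subring_props(5,7)[OF K] by (simp add: a_minus_def)
  have img: "E = (\<lambda>(a, w). a \<otimes> v \<oplus> w) ` (K \<times> E')"
    by (rule Set.set_eqI) (simp add: E line_extension_mem_iff image_iff)
  have "inj_on (\<lambda>(a, w). a \<otimes> v \<oplus> w) (K \<times> E')"
  proof (rule inj_onI, clarsimp)
    fix a w b w'
    assume ab: "a \<in> K" "b \<in> K" and w: "w \<in> E'" "w' \<in> E'"
      and eq: "a \<otimes> v \<oplus> w = b \<otimes> v \<oplus> w'"
    have c: "a \<in> carrier R" "b \<in> carrier R" "w \<in> carrier R" "w' \<in> carrier R"
      using ab w Kc E'_props(1) by auto
    have "(a \<ominus> b) \<otimes> v = w' \<ominus> w"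
    proof -
      have "(a \<ominus> b) \<otimes> v = (a \<otimes> v \<oplus> w) \<ominus> b \<otimes> v \<ominus> w"
        using c v by algebra
      also have "\<dots> = w' \<ominus> w"
        unfolding eq using c v by algebra
      finally show ?thesis .
    qed
    then have in_E': "(a \<ominus> b) \<otimes> v \<in> E'"
      using w E'_props(3,4) by (simp add: a_minus_def)
    have "a = b"
    proof (rule ccontr)
      assume "a \<noteq> b"
      then have "a \<ominus> b \<in> K - {\<zero>}" using Ksub ab c by simp
      then show False using E'_props(6) v in_E' by blast
    qed
    moreover from this have "w = w'" using eq c v by simp
    ultimately show "a = b \<and> w = w'" by simp
  qed
  then show ?case
    using Suc.IH[OF E'] fin by (simp add: img card_image card_cartesian_product)
qed

lemma (in ring) card_subalgebra:
  assumes K: "subfield K R" and fin: "finite (carrier R)" and E: "subalgebra K E R"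
  shows "card E = card K ^ dim K E"
proof -
  have finK: "finite K" and finE: "finite E"
    using subring_props(1)[OF K] subalgebra_in_carrier[OF E] fin by (auto intro: finite_subset)
  obtain es where es: "set es = E" using finE finite_list by blast
  have "Span K es = E"
    using Span_base_incl[OF K] subalgebra_Span_incl[OF K E] es subalgebra_in_carrier[OF E]
    by blast
  then have "finite_dimension K E"
    using Span_finite_dimension[OF K] es subalgebra_in_carrier[OF E] by metis
  then show ?thesis
    using card_eq_card_power_dimension[OF K finK finite_dimensionE[OF K]]
    by (simp only: over_def)
qed

lemma card_linear_code:
  assumes F: "field F" and fin: "finite (carrier F)" and n: "n > 0" and C: "linear_code F n C"
  shows "card C = card (carrier F) ^ code_dim F n C"
proof -
  interpret F: field F by (rule F)
  interpret V: cring "coord_space F n" by (rule cring_coord_space) (rule F.is_cring)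
  have "finite (carrier (coord_space F n))"
    using fin by (auto simp: coord_space_def intro!: finite_PiE)
  moreover have "card (scalars F n) = card (carrier F)"
    unfolding scalars_def
  proof (rule card_image, rule inj_onI)
    fix a b assume "(\<lambda>i\<in>{..<n}. a) = (\<lambda>i\<in>{..<n}. b)"
    then show "a = b" using n by (metis lessThan_iff restrict_apply')
  qed
  ultimately show ?thesis
    using V.card_subalgebra[OF subfield_scalars[OF F n]] C
    by (simp add: linear_code_def code_dim_def)
qed

section \<open>Systematic codes and the MDS property\<close>

definition vec_mat ::
  "('a, 'b) ring_scheme \<Rightarrow> nat \<Rightarrow> (nat \<times> nat \<Rightarrow> 'a) \<Rightarrow> (nat \<Rightarrow> 'a) \<Rightarrow> nat \<Rightarrow> 'a" where
  "vec_mat F k A x c = (\<Oplus>\<^bsub>F\<^esub>i\<in>{..<k}. x i \<otimes>\<^bsub>F\<^esub> A (i, c))"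

definition systematic_word ::
  "('a, 'b) ring_scheme \<Rightarrow> nat \<Rightarrow> nat \<Rightarrow> (nat \<times> nat \<Rightarrow> 'a) \<Rightarrow> (nat \<Rightarrow> 'a) \<Rightarrow> nat \<Rightarrow> 'a" where
  "systematic_word F k m A x = (\<lambda>i\<in>{..<k + m}. if i < k then x i else vec_mat F k A x (i - k))"

definition systematic_code ::
  "('a, 'b) ring_scheme \<Rightarrow> nat \<Rightarrow> nat \<Rightarrow> (nat \<times> nat \<Rightarrow> 'a) \<Rightarrow> (nat \<Rightarrow> 'a) set" where
  "systematic_code F k m A = systematic_word F k m A ` ({..<k} \<rightarrow>\<^sub>E carrier F)"

text \<open>
  The MDS condition on \<open>systematic_code F k m A\<close> in terms of zeros: a nonzero word of an MDS code of
  length \<open>k + m\<close> has weight at least \<open>m + 1\<close>, that is, fewer than \<open>k\<close> zeros.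
\<close>

definition mds_matrix :: "('a, 'b) ring_scheme \<Rightarrow> nat \<Rightarrow> nat \<Rightarrow> (nat \<times> nat \<Rightarrow> 'a) \<Rightarrow> bool" where
  "mds_matrix F k m A \<longleftrightarrow>
     (\<forall>x \<in> {..<k} \<rightarrow>\<^sub>E carrier F. (\<exists>i<k. x i \<noteq> \<zero>\<^bsub>F\<^esub>) \<longrightarrow>
        card {i. i < k + m \<and> systematic_word F k m A x i = \<zero>\<^bsub>F\<^esub>} < k)"

context field
begin

lemma vec_mat_closed:
  assumes "A \<in> {..<k} \<times> {..<m} \<rightarrow> carrier R" "x \<in> {..<k} \<rightarrow> carrier R" "c < m"
  shows "vec_mat R k A x c \<in> carrier R"
  unfolding vec_mat_def using assms by (intro finsum_closed) (auto simp: Pi_iff)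

lemma vec_mat_smult:
  assumes "A \<in> {..<k} \<times> {..<m} \<rightarrow> carrier R" "x \<in> {..<k} \<rightarrow> carrier R" "c < m" "a \<in> carrier R"
  shows "vec_mat R k A (\<lambda>i\<in>{..<k}. a \<otimes> x i) c = a \<otimes> vec_mat R k A x c"
proof -
  have "a \<otimes> vec_mat R k A x c = (\<Oplus>i\<in>{..<k}. a \<otimes> (x i \<otimes> A (i, c)))"
    unfolding vec_mat_def using assms by (intro finsum_rdistr) (auto simp: Pi_iff)
  then show ?thesis
    unfolding vec_mat_def using assms by (auto simp: Pi_iff m_assoc intro!: finsum_cong')
qed

lemma vec_mat_add:
  assumes "A \<in> {..<k} \<times> {..<m} \<rightarrow> carrier R"
    and "x \<in> {..<k} \<rightarrow> carrier R" "y \<in> {..<k} \<rightarrow> carrier R" "c < m"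
  shows "vec_mat R k A (\<lambda>i\<in>{..<k}. x i \<oplus> y i) c = vec_mat R k A x c \<oplus> vec_mat R k A y c"
proof -
  have "vec_mat R k A x c \<oplus> vec_mat R k A y c = (\<Oplus>i\<in>{..<k}. x i \<otimes> A (i, c) \<oplus> y i \<otimes> A (i, c))"
    unfolding vec_mat_def using assms by (intro finsum_addf[symmetric]) (auto simp: Pi_iff)
  also have "\<dots> = vec_mat R k A (\<lambda>i\<in>{..<k}. x i \<oplus> y i) c"
    unfolding vec_mat_def by (rule finsum_cong') (use assms in \<open>auto simp: Pi_iff l_distr\<close>)
  finally show ?thesis ..
qed

lemma vec_mat_minus:
  assumes "A \<in> {..<k} \<times> {..<m} \<rightarrow> carrier R"
    and "x \<in> {..<k} \<rightarrow> carrier R" "y \<in> {..<k} \<rightarrow> carrier R" "c < m"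
  shows "vec_mat R k A (\<lambda>i\<in>{..<k}. x i \<ominus> y i) c = vec_mat R k A x c \<ominus> vec_mat R k A y c"
proof -
  let ?z = "\<lambda>i\<in>{..<k}. x i \<ominus> y i"
  have z: "?z \<in> {..<k} \<rightarrow> carrier R" using assms(2,3) by (auto simp: Pi_iff a_minus_def)
  have "vec_mat R k A x c = vec_mat R k A (\<lambda>i\<in>{..<k}. ?z i \<oplus> y i) c"
    unfolding vec_mat_def using assms by (intro finsum_cong') (auto simp: Pi_iff a_minus_def a_assoc l_neg)
  also have "\<dots> = vec_mat R k A ?z c \<oplus> vec_mat R k A y c"
    by (rule vec_mat_add[OF assms(1) z assms(3,4)])
  finally show ?thesis
    using vec_mat_closed[OF assms(1) z assms(4)] vec_mat_closed[OF assms(1,3,4)]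
    by (simp add: a_minus_def a_assoc r_neg)
qed

lemma vec_mat_mat_minus:
  assumes "A \<in> {..<k} \<times> {..<m} \<rightarrow> carrier R" "B \<in> {..<k} \<times> {..<m} \<rightarrow> carrier R"
    and "x \<in> {..<k} \<rightarrow> carrier R" "c < m"
  shows "vec_mat R k (\<lambda>p. A p \<ominus> B p) x c = vec_mat R k A x c \<ominus> vec_mat R k B x c"
proof -
  have "vec_mat R k (\<lambda>p. A p \<ominus> B p) x c \<oplus> vec_mat R k B x c
        = (\<Oplus>i\<in>{..<k}. x i \<otimes> (A (i, c) \<ominus> B (i, c)) \<oplus> x i \<otimes> B (i, c))"
    unfolding vec_mat_def using assms by (intro finsum_addf[symmetric]) (auto simp: Pi_iff)
  also have "\<dots> = vec_mat R k A x c"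
    unfolding vec_mat_def by (rule finsum_cong')
      (use assms in \<open>auto simp: Pi_iff r_distr[symmetric] a_minus_def a_assoc l_neg\<close>)
  finally have *: "vec_mat R k A x c = vec_mat R k (\<lambda>p. A p \<ominus> B p) x c \<oplus> vec_mat R k B x c" ..
  have "(\<lambda>p. A p \<ominus> B p) \<in> {..<k} \<times> {..<m} \<rightarrow> carrier R"
    using assms(1,2) by (auto simp: Pi_iff)
  from vec_mat_closed[OF this assms(3,4)] vec_mat_closed[OF assms(2,3,4)] show ?thesis
    unfolding * by (simp add: a_minus_def a_assoc r_neg)
qed

lemma vec_mat_eq_single:
  assumes "A \<in> {..<k} \<times> {..<m} \<rightarrow> carrier R" "x \<in> {..<k} \<rightarrow> carrier R" "c < m" "i < k"
    and "\<And>j. j < k \<Longrightarrow> j \<noteq> i \<Longrightarrow> x j \<otimes> A (j, c) = \<zero>"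
  shows "vec_mat R k A x c = x i \<otimes> A (i, c)"
proof -
  have "vec_mat R k A x c = (\<Oplus>j\<in>{..<k}. if i = j then x j \<otimes> A (j, c) else \<zero>)"
    unfolding vec_mat_def using assms by (intro finsum_cong') (auto simp: Pi_iff)
  also have "\<dots> = x i \<otimes> A (i, c)"
    using assms by (intro add.finprod_singleton) (auto simp: Pi_iff)
  finally show ?thesis .
qed

lemma systematic_word_closed:
  assumes "A \<in> {..<k} \<times> {..<m} \<rightarrow> carrier R" "x \<in> {..<k} \<rightarrow> carrier R"
  shows "systematic_word R k m A x \<in> carrier (coord_space R (k + m))"
  using assms vec_mat_closed[OF assms]
  by (auto simp: coord_space_def systematic_word_def Pi_iff)

lemma systematic_word_inj:
  "inj_on (systematic_word R k m A) ({..<k} \<rightarrow>\<^sub>E carrier R)"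
proof (rule inj_onI)
  fix x y assume x: "x \<in> {..<k} \<rightarrow>\<^sub>E carrier R" and y: "y \<in> {..<k} \<rightarrow>\<^sub>E carrier R"
    and eq: "systematic_word R k m A x = systematic_word R k m A y"
  show "x = y"
  proof (rule PiE_ext[OF x y])
    fix i assume "i \<in> {..<k}"
    then show "x i = y i" using fun_cong[OF eq, of i] by (simp add: systematic_word_def)
  qed
qed

lemma systematic_word_smult:
  assumes "A \<in> {..<k} \<times> {..<m} \<rightarrow> carrier R" "x \<in> {..<k} \<rightarrow> carrier R" "i < k + m" "a \<in> carrier R"
  shows "systematic_word R k m A (\<lambda>i\<in>{..<k}. a \<otimes> x i) i = a \<otimes> systematic_word R k m A x i"
  using assms(3) vec_mat_smult[OF assms(1,2) _ assms(4)] by (simp add: systematic_word_def)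

lemma systematic_word_minus:
  assumes "A \<in> {..<k} \<times> {..<m} \<rightarrow> carrier R"
    and "x \<in> {..<k} \<rightarrow> carrier R" "y \<in> {..<k} \<rightarrow> carrier R" "i < k + m"
  shows "systematic_word R k m A (\<lambda>i\<in>{..<k}. x i \<ominus> y i) i
         = systematic_word R k m A x i \<ominus> systematic_word R k m A y i"
  using assms by (auto simp: systematic_word_def vec_mat_minus)

lemma linear_systematic_code:
  assumes A: "A \<in> {..<k} \<times> {..<m} \<rightarrow> carrier R"
  shows "linear_code R (k + m) (systematic_code R k m A)"
proof -
  let ?V = "coord_space R (k + m)" and ?X = "{..<k} \<rightarrow>\<^sub>E carrier R"
  let ?w = "systematic_word R k m A"
  interpret V: cring ?V by (rule cring_coord_space) (rule is_cring)
  have X: "x \<in> {..<k} \<rightarrow> carrier R" if "x \<in> ?X" for x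
    using that by auto
  have car: "?w x \<in> carrier ?V" if "x \<in> ?X" for x
    using systematic_word_closed[OF A X[OF that]] .
  have smult: "(\<lambda>i\<in>{..<k + m}. a) \<otimes>\<^bsub>?V\<^esub> ?w x = ?w (\<lambda>i\<in>{..<k}. a \<otimes> x i)"
    if "a \<in> carrier R" "x \<in> ?X" for a x
    using vec_mat_smult[OF A X[OF that(2)] _ that(1)]
    by (intro ext) (simp add: systematic_word_def coord_space_def)
  have smult_in: "(\<lambda>i\<in>{..<k + m}. a) \<otimes>\<^bsub>?V\<^esub> v \<in> systematic_code R k m A"
    if a: "a \<in> carrier R" and v: "v \<in> systematic_code R k m A" for a v
  proof -
    obtain x where x: "x \<in> ?X" "v = ?w x" using v unfolding systematic_code_def by blast
    have "(\<lambda>i\<in>{..<k}. a \<otimes> x i) \<in> ?X" using X[OF x(1)] a by (simp add: Pi_iff)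
    then show ?thesis unfolding systematic_code_def x(2) smult[OF a x(1)] by (rule imageI)
  qed
  have add: "?w x \<oplus>\<^bsub>?V\<^esub> ?w y = ?w (\<lambda>i\<in>{..<k}. x i \<oplus> y i)" if "x \<in> ?X" "y \<in> ?X" for x y
    using vec_mat_add[OF A X[OF that(1)] X[OF that(2)]]
    by (intro ext) (simp add: systematic_word_def coord_space_def)
  have neg: "\<ominus>\<^bsub>?V\<^esub> v = (\<lambda>i\<in>{..<k + m}. \<ominus> \<one>) \<otimes>\<^bsub>?V\<^esub> v" if v: "v \<in> carrier ?V" for v
  proof -
    have "\<And>i. i < k + m \<Longrightarrow> v i \<in> carrier R" using v by (auto simp: coord_space_def)
    then have "(\<lambda>i\<in>{..<k + m}. \<ominus> \<one>) \<otimes>\<^bsub>?V\<^esub> v \<oplus>\<^bsub>?V\<^esub> v = \<zero>\<^bsub>?V\<^esub>"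
      by (auto simp: coord_space_def l_minus l_neg intro!: restrict_ext)
    moreover have "(\<lambda>i\<in>{..<k + m}. \<ominus> \<one>) \<otimes>\<^bsub>?V\<^esub> v \<in> carrier ?V"
      using v by (intro V.m_closed) (auto simp: coord_space_def)
    ultimately show ?thesis using v V.minus_equality by blast
  qed
  have sub: "systematic_code R k m A \<subseteq> carrier ?V"
    unfolding systematic_code_def using car by (rule image_subsetI)
  have "subgroup (systematic_code R k m A) (add_monoid ?V)"
  proof (rule V.add.subgroupI)
    show "systematic_code R k m A \<subseteq> carrier ?V" by (rule sub)
    have "(\<lambda>i\<in>{..<k}. \<zero>) \<in> ?X" by simp
    then show "systematic_code R k m A \<noteq> {}" unfolding systematic_code_def by blast
    fix v assume v: "v \<in> systematic_code R k m A"
    have "\<ominus> \<one> \<in> carrier R" by simp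
    then show "\<ominus>\<^bsub>?V\<^esub> v \<in> systematic_code R k m A"
      unfolding neg[OF subsetD[OF sub v]] using v by (rule smult_in)
    fix w assume "w \<in> systematic_code R k m A"
    with v obtain x y where xy: "x \<in> ?X" "y \<in> ?X" "v = ?w x" "w = ?w y"
      unfolding systematic_code_def by blast
    moreover have "(\<lambda>i\<in>{..<k}. x i \<oplus> y i) \<in> ?X"
      using X[OF xy(1)] X[OF xy(2)] by (simp add: Pi_iff)
    ultimately show "v \<oplus>\<^bsub>?V\<^esub> w \<in> systematic_code R k m A"
      unfolding systematic_code_def by (simp only: add) (rule imageI)
  qed
  moreover have "subalgebra_axioms (scalars R (k + m)) (systematic_code R k m A) ?V"
    using smult_in unfolding scalars_def subalgebra_axioms_def by blast
  ultimately show ?thesis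
    unfolding linear_code_def by (rule subalgebra.intro)
qed

lemma card_systematic_code:
  "card (systematic_code R k m A) = card (carrier R) ^ k"
  unfolding systematic_code_def by (simp add: card_image systematic_word_inj card_PiE)

lemma power_card_carrier_le_iff:
  assumes "finite (carrier R)"
  shows "card (carrier R) ^ a \<le> card (carrier R) ^ b \<longleftrightarrow> a \<le> b"
proof -
  have "card {\<zero>, \<one>} \<le> card (carrier R)" using assms by (intro card_mono) auto
  then have "1 < card (carrier R)" by simp
  then show ?thesis by (rule power_increasing_iff)
qed

text \<open>
  Two distinct words agree in fewer than \<open>k\<close> positions, since their difference is again a nonzero
  word of the code. That the distance \<open>m + 1\<close> is attained needs two explicit words.
\<close>

lemma systematic_code_mds:
  assumes fin: "finite (carrier R)" and k: "k > 0"
    and A: "A \<in> {..<k} \<times> {..<m} \<rightarrow> carrier R" and mds: "mds_matrix R k m A"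
  shows "systematic_code R k m A \<in> mds_codes R k (k + m)"
proof -
  let ?w = "systematic_word R k m A" and ?C = "systematic_code R k m A"
  let ?X = "{..<k} \<rightarrow>\<^sub>E carrier R"
  let ?D = "{hamming_dist (k + m) v w | v w. v \<in> ?C \<and> w \<in> ?C \<and> v \<noteq> w}"
  have lin: "linear_code R (k + m) ?C" by (rule linear_systematic_code[OF A])
  have "card (carrier R) ^ code_dim R (k + m) ?C = card (carrier R) ^ k"
    using card_linear_code[OF field_axioms fin _ lin] k by (simp add: card_systematic_code)
  then have dim: "code_dim R (k + m) ?C = k"
    by (intro antisym) (simp_all flip: power_card_carrier_le_iff[OF fin])
  have complement: "hamming_dist (k + m) v w = k + m - card {i. i < k + m \<and> v i = w i}" for v w :: "nat \<Rightarrow> 'a"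
  proof -
    have "{i. i < k + m \<and> v i \<noteq> w i} = {..<k + m} - {i. i < k + m \<and> v i = w i}" by auto
    then show ?thesis by (simp add: hamming_dist_def card_Diff_subset subset_iff)
  qed
  have X: "x \<in> {..<k} \<rightarrow> carrier R" if "x \<in> ?X" for x
    using that by auto
  have lower: "m + 1 \<le> hamming_dist (k + m) (?w x) (?w y)" if x: "x \<in> ?X" and y: "y \<in> ?X" and ne: "x \<noteq> y" for x y
  proof -
    let ?z = "\<lambda>i\<in>{..<k}. x i \<ominus> y i"
    have z: "?z \<in> ?X" using X[OF x] X[OF y] by (auto simp: Pi_iff a_minus_def)
    obtain i where i: "i < k" "x i \<noteq> y i" using PiE_ext[OF x y] ne by blast
    have car: "?w x i \<in> carrier R" "?w y i \<in> carrier R" if "i < k + m" for i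
      using systematic_word_closed[OF A X[OF x]] systematic_word_closed[OF A X[OF y]] that
      by (auto simp: coord_space_def PiE_iff)
    have "?z i \<noteq> \<zero>" using i X[OF x] X[OF y] by (auto simp: Pi_iff)
    then have "card {j. j < k + m \<and> ?w ?z j = \<zero>} < k"
      using mds z i(1) unfolding mds_matrix_def by blast
    moreover have "{j. j < k + m \<and> ?w ?z j = \<zero>} = {j. j < k + m \<and> ?w x j = ?w y j}"
      using systematic_word_minus[OF A X[OF x] X[OF y]] car by auto
    ultimately show ?thesis unfolding complement by simp
  qed
  have fin_D: "finite ?D"
  proof (rule finite_subset)
    show "?D \<subseteq> {..k + m}" unfolding complement by (rule subsetI) (elim CollectE exE, simp)
  qed simp
  \<comment> \<open>The words with information parts \<open>0\<close> and \<open>(1, 0, ..., 0)\<close> agree on the last \<open>k - 1\<close>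
     of the first \<open>k\<close> coordinates, so the Singleton bound is attained.\<close>
  define x where "x = (\<lambda>i\<in>{..<k}. if i = 0 then \<one> else \<zero>)"
  define y where "y = (\<lambda>i\<in>{..<k}. \<zero>)"
  have xy: "x \<in> ?X" "y \<in> ?X" by (auto simp: x_def y_def)
  have "x 0 \<noteq> y 0" using k by (simp add: x_def y_def)
  then have ne: "x \<noteq> y" by auto
  have ne': "?w x \<noteq> ?w y" using inj_onD[OF systematic_word_inj _ xy] ne by blast
  have "{1..<k} \<subseteq> {i. i < k + m \<and> ?w x i = ?w y i}"
    by (auto simp: systematic_word_def x_def y_def)
  then have "card {1..<k} \<le> card {i. i < k + m \<and> ?w x i = ?w y i}"
    by (intro card_mono) auto
  then have "hamming_dist (k + m) (?w x) (?w y) \<le> m + 1"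
    unfolding complement using k by simp
  with lower[OF xy ne] have "hamming_dist (k + m) (?w x) (?w y) = m + 1" by simp
  then have attained: "m + 1 \<in> ?D"
    using imageI[OF xy(1), of ?w] imageI[OF xy(2), of ?w] ne'
    unfolding systematic_code_def mem_Collect_eq by (intro exI conjI) (erule sym)
  have "min_dist (k + m) ?C = m + 1"
    unfolding min_dist_def
  proof (rule Min_eqI[OF fin_D _ attained])
    fix d assume "d \<in> ?D"
    then obtain x y where "x \<in> ?X" "y \<in> ?X" "?w x \<noteq> ?w y" "d = hamming_dist (k + m) (?w x) (?w y)"
      unfolding systematic_code_def by blast
    then show "m + 1 \<le> d" using lower[of x y] by metis
  qed
  then show ?thesis using lin dim unfolding mds_codes_def by simp
qed

end

section \<open>Most matrices give MDS codes\<close>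

context field
begin

text \<open>
  The pairs have one degree of freedom less than the matrices alone. Suppose \<open>j\<close> of the \<open>k\<close>
  positions in \<open>T\<close> are redundancy positions. The other \<open>k - j\<close> fix coordinates of \<open>x\<close> to zero,
  so that \<open>x\<close>, with \<open>x i = 1\<close>, has \<open>j - 1\<close> free coordinates. Each redundancy position in \<open>T\<close>
  is a linear equation for one column of \<open>A\<close> in which the entry of row \<open>i\<close> has coefficient \<open>1\<close>,
  so that this entry is determined by the rest of the column; this leaves \<open>k m - j\<close> free entries.
\<close>

lemma card_vanishing_pairs:
  assumes fin: "finite (carrier R)" and i: "i < k" and T: "T \<subseteq> {..<k + m}" "card T = k"
  defines "S \<equiv> {(x, A). x \<in> {..<k} \<rightarrow>\<^sub>E carrier R \<and> A \<in> {..<k} \<times> {..<m} \<rightarrow>\<^sub>E carrier R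
                  \<and> x i = \<one> \<and> (\<forall>t\<in>T. systematic_word R k m A x t = \<zero>)}"
  shows "card (carrier R) * card S \<le> card (carrier R) ^ (k * m)"
proof (cases "i \<in> T")
  case True
  have "S = {}"
    unfolding S_def using True i by (force simp: systematic_word_def)
  then show ?thesis by simp
next
  case False
  define T1 where "T1 = T \<inter> {..<k}"
  define T2 where "T2 = {c. k + c \<in> T}"
  define U where "U = {..<k} - T1 - {i}"
  define W where "W = {..<k} \<times> {..<m} - {i} \<times> T2"
  have T2m: "T2 \<subseteq> {..<m}" using T(1) by (auto simp: T2_def)
  have finT: "finite T1" "finite T2" using T2m by (auto simp: T1_def intro: finite_subset)
  have split: "card T1 + card T2 = k"
  proof -
    have "T = T1 \<union> (\<lambda>c. k + c) ` T2"
      by (auto simp: T1_def T2_def image_iff) (metis le_add_diff_inverse not_less)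
    then have "card T = card T1 + card ((\<lambda>c. k + c) ` T2)"
      using card_Un_disjoint[of T1 "(\<lambda>c. k + c) ` T2"] finT by (auto simp: T1_def)
    then show ?thesis using T(2) by (simp add: card_image)
  qed
  have iT1: "T1 \<subseteq> {..<k} - {i}" using False by (auto simp: T1_def)
  have "card T1 \<le> k - 1" using card_mono[OF _ iT1] i by simp
  then have T2_pos: "card T2 > 0" using split i by linarith
  have "U = {..<k} - {i} - T1" by (auto simp: U_def)
  then have cU: "card U = k - 1 - card T1"
    using card_Diff_subset[OF finT(1) iT1] i by simp
  have "card T2 \<le> m" using card_mono[OF _ T2m] by simp
  also have "m \<le> k * m" using i by simp
  finally have T2_le: "card T2 \<le> k * m" .
  have cW: "card W = k * m - card T2"
    unfolding W_def using i T2m finT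
    by (subst card_Diff_subset) (auto simp: card_cartesian_product)
  have exponents: "Suc (card U + card W) = k * m"
    using cU cW T2_pos T2_le split by linarith
  let ?f = "\<lambda>(x, A). (restrict x U, restrict A W)"
  have range: "?f ` S \<subseteq> (U \<rightarrow>\<^sub>E carrier R) \<times> (W \<rightarrow>\<^sub>E carrier R)"
  proof (rule image_subsetI, clarify)
    fix x A assume "(x, A) \<in> S"
    then have "x \<in> {..<k} \<rightarrow>\<^sub>E carrier R" "A \<in> {..<k} \<times> {..<m} \<rightarrow>\<^sub>E carrier R"
      by (simp_all add: S_def)
    then show "restrict x U \<in> (U \<rightarrow>\<^sub>E carrier R) \<and> restrict A W \<in> (W \<rightarrow>\<^sub>E carrier R)"
      by (auto simp: U_def W_def PiE_iff)
  qed
  \<comment> \<open>The entries of \<open>A\<close> outside \<open>W\<close> are those solved for by the equations at the positions in \<open>T2\<close>.\<close>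
  have inj: "inj_on ?f S"
  proof (rule inj_onI, clarify)
    fix x A y B
    assume "(x, A) \<in> S" "(y, B) \<in> S" and U: "restrict x U = restrict y U"
      and W: "restrict A W = restrict B W"
    then have x: "x \<in> {..<k} \<rightarrow>\<^sub>E carrier R" and y: "y \<in> {..<k} \<rightarrow>\<^sub>E carrier R"
      and A: "A \<in> {..<k} \<times> {..<m} \<rightarrow>\<^sub>E carrier R" and B: "B \<in> {..<k} \<times> {..<m} \<rightarrow>\<^sub>E carrier R"
      and xi: "x i = \<one>" and yi: "y i = \<one>"
      and x0: "\<And>t. t \<in> T \<Longrightarrow> systematic_word R k m A x t = \<zero>"
      and y0: "\<And>t. t \<in> T \<Longrightarrow> systematic_word R k m B y t = \<zero>"
      by (simp_all add: S_def)
    have xU: "x j = y j" if "j \<in> U" for j using fun_cong[OF U, of j] that by simp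
    have AW: "A p = B p" if "p \<in> W" for p using fun_cong[OF W, of p] that by simp
    have xy: "x = y"
    proof (rule PiE_ext[OF x y])
      fix j assume j: "j \<in> {..<k}"
      consider "j \<in> T" | "j = i" | "j \<in> U" using j by (auto simp: U_def T1_def)
      then show "x j = y j"
      proof cases
        case 1
        then show ?thesis using x0[of j] y0[of j] j by (simp add: systematic_word_def)
      qed (simp_all add: xi yi xU)
    qed
    have cA: "A \<in> {..<k} \<times> {..<m} \<rightarrow> carrier R" and cB: "B \<in> {..<k} \<times> {..<m} \<rightarrow> carrier R"
      and cx: "x \<in> {..<k} \<rightarrow> carrier R" using A B x by auto
    have "A = B"
    proof (rule PiE_ext[OF A B])
      fix p assume p: "p \<in> {..<k} \<times> {..<m}"
      show "A p = B p"
      proof (cases "p \<in> W")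
        case False
        then obtain c where c: "c \<in> T2" "p = (i, c)" using p by (auto simp: W_def)
        have cm: "c < m" using c(1) T2m by auto
        have t: "k + c \<in> T" using c(1) by (simp add: T2_def)
        have vA: "vec_mat R k A x c = \<zero>" and vB: "vec_mat R k B x c = \<zero>"
          using x0[OF t] y0[OF t] cm xy by (simp_all add: systematic_word_def)
        have cAB: "(\<lambda>p. A p \<ominus> B p) \<in> {..<k} \<times> {..<m} \<rightarrow> carrier R"
          using cA cB by (auto simp: Pi_iff)
        have "vec_mat R k (\<lambda>p. A p \<ominus> B p) x c = x i \<otimes> (A (i, c) \<ominus> B (i, c))"
        proof (rule vec_mat_eq_single[OF cAB cx cm i])
          fix j assume j: "j < k" "j \<noteq> i"
          then have "A (j, c) = B (j, c)" using cm by (intro AW) (simp add: W_def)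
          moreover have "B (j, c) \<in> carrier R" "x j \<in> carrier R"
            using cB cx j cm by (auto simp: Pi_iff)
          ultimately show "x j \<otimes> (A (j, c) \<ominus> B (j, c)) = \<zero>" by (simp add: a_minus_def r_neg)
        qed
        moreover have "vec_mat R k (\<lambda>p. A p \<ominus> B p) x c = \<zero>"
          unfolding vec_mat_mat_minus[OF cA cB cx cm] vA vB by simp
        moreover have "A (i, c) \<in> carrier R" "B (i, c) \<in> carrier R"
          using cA cB i cm by (auto simp: Pi_iff)
        ultimately show ?thesis unfolding c(2) xi by (metis l_one minus_closed r_right_minus_eq)
      qed (rule AW)
    qed
    with xy show "x = y \<and> A = B" by simp
  qed
  have finUW: "finite U" "finite W" by (simp_all add: U_def W_def)
  have "finite ((U \<rightarrow>\<^sub>E carrier R) \<times> (W \<rightarrow>\<^sub>E carrier R))"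
    using fin finUW by (simp add: finite_PiE)
  then have "card S \<le> card ((U \<rightarrow>\<^sub>E carrier R) \<times> (W \<rightarrow>\<^sub>E carrier R))"
    by (rule card_inj_on_le[OF inj range])
  also have "\<dots> = card (carrier R) ^ (card U + card W)"
    using finUW by (simp add: card_cartesian_product card_PiE power_add)
  finally have "card (carrier R) * card S \<le> card (carrier R) ^ Suc (card U + card W)" by simp
  then show ?thesis unfolding exponents .
qed

text \<open>
  A union bound over the sets \<open>T\<close> of \<open>k\<close> positions on which a bad word \<open>x\<close> vanishes, and over the
  coordinate of \<open>x\<close> that is scaled to \<open>1\<close>. The scaling matters: without it the number of pairs
  \<open>(x, A)\<close> would be of the same order as the number of all matrices.
\<close>

lemma card_not_mds_matrix:
  assumes fin: "finite (carrier R)"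
  shows "card (carrier R) * card {A \<in> {..<k} \<times> {..<m} \<rightarrow>\<^sub>E carrier R. \<not> mds_matrix R k m A}
         \<le> k * 2 ^ (k + m) * card (carrier R) ^ (k * m)"
proof -
  let ?X = "{..<k} \<rightarrow>\<^sub>E carrier R" and ?Mats = "{..<k} \<times> {..<m} \<rightarrow>\<^sub>E carrier R"
  let ?w = "systematic_word R k m"
  define S where "S T i = {(x, A). x \<in> ?X \<and> A \<in> ?Mats \<and> x i = \<one> \<and> (\<forall>t\<in>T. ?w A x t = \<zero>)}" for T i
  define \<T> where "\<T> = {T. T \<subseteq> {..<k + m} \<and> card T = k}"
  have finX: "finite (?X \<times> ?Mats)" using fin by (simp add: finite_PiE)
  have finS: "finite (S T i)" for T i
    by (rule finite_subset[OF _ finX]) (auto simp: S_def)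
  have fin\<T>: "finite \<T>" by (rule finite_subset[of _ "Pow {..<k + m}"]) (auto simp: \<T>_def)
  have "card \<T> \<le> card (Pow {..<k + m})" by (rule card_mono) (auto simp: \<T>_def)
  then have card\<T>: "card \<T> \<le> 2 ^ (k + m)" by (simp add: card_Pow)
  have cover: "{A \<in> ?Mats. \<not> mds_matrix R k m A} \<subseteq> (\<Union>(T, i)\<in>\<T> \<times> {..<k}. snd ` S T i)"
  proof (rule subsetI)
    fix A assume "A \<in> {A \<in> ?Mats. \<not> mds_matrix R k m A}"
    then obtain x i where A: "A \<in> ?Mats" and x: "x \<in> ?X" and i: "i < k" "x i \<noteq> \<zero>"
      and zeros: "k \<le> card {t. t < k + m \<and> ?w A x t = \<zero>}"
      unfolding mds_matrix_def not_less[symmetric] by blast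
    obtain T where T: "T \<subseteq> {t. t < k + m \<and> ?w A x t = \<zero>}" "card T = k"
      by (rule obtain_subset_with_card_n[OF zeros])
    have cA: "A \<in> {..<k} \<times> {..<m} \<rightarrow> carrier R" and cx: "x \<in> {..<k} \<rightarrow> carrier R"
      using A x by auto
    have xi: "x i \<in> Units R" using cx i by (simp add: Pi_iff field_Units)
    define y where "y = (\<lambda>j\<in>{..<k}. inv (x i) \<otimes> x j)"
    have "?w A y t = \<zero>" if "t \<in> T" for t
    proof -
      have "t < k + m" "?w A x t = \<zero>" using that T(1) by auto
      then show ?thesis
        unfolding y_def using systematic_word_smult[OF cA cx] xi by simp
    qed
    moreover have "y \<in> ?X" using cx xi by (simp add: y_def Pi_iff)
    moreover have "y i = \<one>" using i xi by (simp add: y_def)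
    ultimately have "(y, A) \<in> S T i" using A by (simp add: S_def)
    then have "A \<in> snd ` S T i" by (rule image_eqI[rotated]) simp
    moreover have "T \<in> \<T>" using T by (auto simp: \<T>_def)
    ultimately show "A \<in> (\<Union>(T, i)\<in>\<T> \<times> {..<k}. snd ` S T i)" using i(1) by blast
  qed
  have "card {A \<in> ?Mats. \<not> mds_matrix R k m A} \<le> card (\<Union>(T, i)\<in>\<T> \<times> {..<k}. snd ` S T i)"
    by (rule card_mono[OF _ cover]) (use fin\<T> finS in auto)
  also have "\<dots> \<le> (\<Sum>(T, i)\<in>\<T> \<times> {..<k}. card (snd ` S T i))"
    unfolding split_beta by (rule card_UN_le) (use fin\<T> in simp)
  also have "\<dots> \<le> (\<Sum>(T, i)\<in>\<T> \<times> {..<k}. card (S T i))"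
    by (rule sum_mono) (use finS in \<open>simp add: split_beta card_image_le\<close>)
  finally have "card (carrier R) * card {A \<in> ?Mats. \<not> mds_matrix R k m A}
      \<le> card (carrier R) * (\<Sum>(T, i)\<in>\<T> \<times> {..<k}. card (S T i))" by (rule mult_le_mono2)
  also have "\<dots> = (\<Sum>(T, i)\<in>\<T> \<times> {..<k}. card (carrier R) * card (S T i))"
    by (simp add: sum_distrib_left split_beta)
  also have "\<dots> \<le> (\<Sum>(T, i)\<in>\<T> \<times> {..<k}. card (carrier R) ^ (k * m))"
  proof (rule sum_mono, clarify)
    fix T i assume "T \<in> \<T>" "i < k"
    then show "card (carrier R) * card (S T i) \<le> card (carrier R) ^ (k * m)"
      unfolding S_def \<T>_def using card_vanishing_pairs[OF fin, of i k T m] by blast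
  qed
  also have "\<dots> = card \<T> * k * card (carrier R) ^ (k * m)"
    by (simp add: split_beta card_cartesian_product)
  also have "\<dots> \<le> k * 2 ^ (k + m) * card (carrier R) ^ (k * m)"
    using card\<T> by (simp add: mult.commute mult_le_mono)
  finally show ?thesis .
qed

end

section \<open>Matrices with Reed-Solomon words on the diagonals\<close>

text \<open>
  The minimum distance of a Reed-Solomon code. The sum is the value at \<open>x\<close> of the polynomial with
  coefficients \<open>c\<close>, to which the general bound on the number of roots applies.
\<close>

lemma (in field) card_roots_finsum_le:
  assumes fin: "finite (carrier R)"
    and c: "c \<in> {..r} \<rightarrow> carrier R" and nz: "t0 \<le> r" "c t0 \<noteq> \<zero>"
  shows "card {x \<in> carrier R. (\<Oplus>t\<in>{..r}. c t \<otimes> x [^] t) = \<zero>} \<le> r"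
proof -
  interpret UP: UP_domain R "UP R" by unfold_locales simp
  define f where "f = (\<Oplus>\<^bsub>UP R\<^esub>t\<in>{..r}. up_ring.monom (UP R) (c t) t)"
  have mc: "(\<lambda>t. up_ring.monom (UP R) (c t) t) \<in> {..r} \<rightarrow> carrier (UP R)"
    using c by (simp add: Pi_iff)
  have fc: "f \<in> carrier (UP R)"
    unfolding f_def using mc by (rule UP.finsum_closed)
  have coeff: "up_ring.coeff (UP R) f s = (if s \<le> r then c s else \<zero>)" for s
  proof -
    have "up_ring.coeff (UP R) f s = (\<Oplus>t\<in>{..r}. up_ring.coeff (UP R) (up_ring.monom (UP R) (c t) t) s)"
      unfolding f_def by (rule UP.coeff_finsum[OF _ mc]) simp
    also have "\<dots> = (\<Oplus>t\<in>{..r}. if t = s then c t else \<zero>)"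
    proof (rule finsum_cong')
      show "(\<lambda>t. if t = s then c t else \<zero>) \<in> {..r} \<rightarrow> carrier R" using c by (simp add: Pi_iff)
      fix t assume "t \<in> {..r}"
      then have "c t \<in> carrier R" using c by (rule funcset_mem[rotated])
      then show "up_ring.coeff (UP R) (up_ring.monom (UP R) (c t) t) s = (if t = s then c t else \<zero>)"
        by (simp add: UP.coeff_monom)
    qed simp
    also have "\<dots> = (if s \<le> r then c s else \<zero>)"
    proof (cases "s \<le> r")
      case True
      then show ?thesis using c add.finprod_singleton_swap[of s "{..r}" c] by simp
    next
      case False
      then have "(\<Oplus>t\<in>{..r}. if t = s then c t else \<zero>) = \<zero>"
        by (intro add.finprod_one_eqI) auto
      then show ?thesis using False by simp
    qed
    finally show ?thesis .
  qed
  have nz: "f \<noteq> \<zero>\<^bsub>UP R\<^esub>" using coeff[of t0] nz by auto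
  have deg: "deg R f \<le> r" by (rule UP.deg_aboveI[OF _ fc]) (simp add: coeff)
  have ev: "UnivPoly.eval R R id x f = (\<Oplus>t\<in>{..r}. c t \<otimes> x [^] t)" if x: "x \<in> carrier R" for x
  proof -
    have "UnivPoly.eval R R id x (\<Oplus>\<^bsub>UP R\<^esub>t\<in>T. up_ring.monom (UP R) (c t) t) = (\<Oplus>t\<in>T. c t \<otimes> x [^] t)"
      if "finite T" "c \<in> T \<rightarrow> carrier R" for T
      using that
    proof (induction T)
      case empty
      have "UnivPoly.eval R R id x (up_ring.monom (UP R) \<zero> 0) = \<zero> \<otimes> x [^] (0::nat)"
        using x by (intro UP.evalRR_monom) simp_all
      then show ?case by (simp add: id_def)
    next
      case (insert t T)
      let ?g = "\<lambda>t. up_ring.monom (UP R) (c t) t"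
      from insert have ct: "c t \<in> carrier R" and cT: "c \<in> T \<rightarrow> carrier R" by auto
      have g: "?g t \<in> carrier (UP R)" "?g \<in> T \<rightarrow> carrier (UP R)"
        using ct cT by (simp_all add: Pi_iff)
      have "(\<lambda>t. c t \<otimes> x [^] t) \<in> T \<rightarrow> carrier R" using cT x by (simp add: Pi_iff)
      then show ?case
        using UP.evalRR_add[OF g(1) UP.finsum_closed[OF g(2)] x] UP.evalRR_monom[OF ct x, of t]
          insert.IH[OF cT] finsum_insert[OF insert.hyps] UP.finsum_insert[OF insert.hyps g(2,1)] ct x
        by (simp only: finsum_insert[OF insert.hyps] m_closed nat_pow_closed)
    qed
    from this[OF _ c] show ?thesis unfolding f_def by simp
  qed
  have "{x \<in> carrier R. (\<Oplus>t\<in>{..r}. c t \<otimes> x [^] t) = \<zero>}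
        = {x \<in> carrier R. UnivPoly.eval R R id x f = \<zero>}"
    by (intro Collect_cong conj_cong refl) (simp only: ev)
  then show ?thesis using UP.roots_bound[OF fc nz fin] deg by simp
qed

text \<open>
  The coefficients \<open>g\<close> form a \<open>(u + 1) \<times> w\<close> matrix, and those on the diagonal \<open>b - a = d\<close>
  determine the diagonal \<open>c - i = d\<close> of the result, as the values at the points \<open>\<alpha> i\<close> of one
  polynomial. On a fixed diagonal \<open>min a b\<close> runs through \<open>0, 1, 2, ...\<close>, so it serves as the
  exponent that belongs to \<open>g (a, b)\<close>; this keeps the degree below the length of the diagonal of \<open>g\<close>.
\<close>

definition diagonal_matrix ::
  "('a, 'b) ring_scheme \<Rightarrow> nat \<Rightarrow> nat \<Rightarrow> (nat \<Rightarrow> 'a) \<Rightarrow> (nat \<times> nat \<Rightarrow> 'a) \<Rightarrow> nat \<times> nat \<Rightarrow> 'a" where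
  "diagonal_matrix F u w \<alpha> g = (\<lambda>(i, c).
     \<Oplus>\<^bsub>F\<^esub>p\<in>{p \<in> {..u} \<times> {..<w}. fst p + c = snd p + i}. g p \<otimes>\<^bsub>F\<^esub> \<alpha> i [^]\<^bsub>F\<^esub> min (fst p) (snd p))"

context field
begin

lemma diagonal_matrix_closed:
  assumes "g \<in> {..u} \<times> {..<w} \<rightarrow> carrier R" "\<alpha> i \<in> carrier R"
  shows "diagonal_matrix R u w \<alpha> g (i, c) \<in> carrier R"
  unfolding diagonal_matrix_def split
  by (rule finsum_closed) (use assms in \<open>auto simp: Pi_iff\<close>)

lemma diagonal_matrix_minus:
  assumes "g \<in> {..u} \<times> {..<w} \<rightarrow> carrier R" "h \<in> {..u} \<times> {..<w} \<rightarrow> carrier R"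
    and "\<alpha> i \<in> carrier R"
  shows "diagonal_matrix R u w \<alpha> (\<lambda>p. g p \<ominus> h p) (i, c)
         = diagonal_matrix R u w \<alpha> g (i, c) \<ominus> diagonal_matrix R u w \<alpha> h (i, c)"
proof -
  let ?I = "{p \<in> {..u} \<times> {..<w}. fst p + c = snd p + i}"
  let ?e = "\<lambda>p. \<alpha> i [^] min (fst p) (snd p :: nat)"
  have gh: "(\<lambda>p. g p \<ominus> h p) \<in> {..u} \<times> {..<w} \<rightarrow> carrier R"
    using assms by (auto simp: Pi_iff)
  have cl: "(\<lambda>p. f p \<otimes> ?e p) \<in> ?I \<rightarrow> carrier R" if "f \<in> {..u} \<times> {..<w} \<rightarrow> carrier R" for f
    using that assms(3) by (auto simp: Pi_iff)
  have "diagonal_matrix R u w \<alpha> (\<lambda>p. g p \<ominus> h p) (i, c) \<oplus> diagonal_matrix R u w \<alpha> h (i, c)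
        = (\<Oplus>p\<in>?I. (g p \<ominus> h p) \<otimes> ?e p \<oplus> h p \<otimes> ?e p)"
    unfolding diagonal_matrix_def split by (rule finsum_addf[symmetric]) (rule cl[OF gh] cl[OF assms(2)])+
  also have "\<dots> = diagonal_matrix R u w \<alpha> g (i, c)"
    unfolding diagonal_matrix_def split
  proof (rule finsum_cong'[OF refl cl[OF assms(1)]])
    fix p assume "p \<in> ?I"
    then have "g p \<in> carrier R" "h p \<in> carrier R" "?e p \<in> carrier R"
      using assms by (auto simp: Pi_iff)
    then show "(g p \<ominus> h p) \<otimes> ?e p \<oplus> h p \<otimes> ?e p = g p \<otimes> ?e p"
      by (simp add: l_distr[symmetric] a_minus_def a_assoc l_neg)
  qed
  finally show ?thesis
    using diagonal_matrix_closed[of _ u w \<alpha> i c] gh assms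
    by (metis a_minus_def add.inv_solve_right')
qed

text \<open>
  The rank bound, in the form that at least \<open>k - u\<close> coordinates of a vector \<open>x\<close> of the left kernel
  are determined by the others. Let \<open>(a, b), (a + 1, b + 1), ...\<close> be the first diagonal
  on which \<open>h\<close> does not vanish; its last index is \<open>(a + r, b + r)\<close>. The corresponding diagonal of
  the matrix has \<open>r + (k - u)\<close> entries, and at most \<open>r\<close> of them are zero, as they are values of a
  nonzero polynomial of degree at most \<open>r\<close>. \<open>I\<close> consists of the rows of the nonzero ones. All
  entries to the left of this diagonal vanish, so the column through a nonzero entry in row \<open>i\<close>
  expresses \<open>x i\<close> by the \<open>x j\<close> with \<open>j < i\<close>.
\<close>

lemma diagonal_matrix_kernel:
  fixes k m u w :: nat
  assumes fin: "finite (carrier R)"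
    and \<alpha>: "\<alpha> \<in> {..<k} \<rightarrow> carrier R" "inj_on \<alpha> {..<k}"
    and uk: "u < k" and w: "m + u + 1 = k + w"
    and h: "h \<in> {..u} \<times> {..<w} \<rightarrow> carrier R"
    and nz: "p0 \<in> {..u} \<times> {..<w}" "h p0 \<noteq> \<zero>"
  obtains I where "I \<subseteq> {..<k}" "k - u \<le> card I"
    "\<And>x. \<lbrakk>x \<in> {..<k} \<rightarrow> carrier R; \<And>c. c < m \<Longrightarrow> vec_mat R k (diagonal_matrix R u w \<alpha> h) x c = \<zero>;
          \<And>i. i \<in> {..<k} - I \<Longrightarrow> x i = \<zero>\<rbrakk> \<Longrightarrow> \<forall>i<k. x i = \<zero>"
proof -
  let ?D = "diagonal_matrix R u w \<alpha> h"
  \<comment> \<open>The first nonzero diagonal minimises \<open>b - a\<close>; adding \<open>u\<close> keeps this a natural number.\<close>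
  have "\<exists>p. (p \<in> {..u} \<times> {..<w} \<and> h p \<noteq> \<zero>) \<and>
      (\<forall>q. q \<in> {..u} \<times> {..<w} \<and> h q \<noteq> \<zero> \<longrightarrow> snd p + u - fst p \<le> snd q + u - fst q)"
    by (rule ex_has_least_nat[where k = p0]) (use nz in blast)
  then obtain a0 b0 where a0: "a0 \<le> u" and b0: "b0 < w" and h0: "h (a0, b0) \<noteq> \<zero>"
    and least: "\<And>a b. a \<le> u \<Longrightarrow> b < w \<Longrightarrow> h (a, b) \<noteq> \<zero> \<Longrightarrow> b0 + u - a0 \<le> b + u - a"
    by (auto simp del: split_paired_Ex split_paired_All) (metis SigmaI atMost_iff fst_conv lessThan_iff snd_conv)
  \<comment> \<open>Moving up the diagonal from \<open>(a0, b0)\<close> to the border gives its first index \<open>(a, b)\<close>.\<close>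
  define t0 where "t0 = min a0 b0"
  define a where "a = a0 - t0"
  define b where "b = b0 - t0"
  define r where "r = min (u - a) (w - 1 - b)"
  have ab: "a0 = a + t0" "b0 = b + t0" "a = 0 \<or> b = 0" "t0 \<le> r" "a + r \<le> u" "b + r < w"
    using a0 b0 by (auto simp: t0_def a_def b_def r_def)
  have Dc: "?D (i, c) \<in> carrier R" if "i < k" for i c
    using diagonal_matrix_closed[OF h] \<alpha>(1) that by (simp add: Pi_iff)
  have below: "?D (i, c) = \<zero>" if "i < k" and ic: "c + a < b + i" for i c
    unfolding diagonal_matrix_def split
  proof (rule add.finprod_one_eqI)
    fix p assume p: "p \<in> {p \<in> {..u} \<times> {..<w}. fst p + c = snd p + i}"
    have "h p = \<zero>"
    proof (rule ccontr)
      assume "h p \<noteq> \<zero>"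
      then have "b0 + u - a0 \<le> snd p + u - fst p" using least[of "fst p" "snd p"] p by auto
      then show False using p ic ab a0 by auto
    qed
    then show "h p \<otimes> \<alpha> i [^] min (fst p) (snd p) = \<zero>"
      using \<alpha>(1) that by (simp add: Pi_iff)
  qed
  have on: "?D (a + s, b + s) = (\<Oplus>t\<in>{..r}. h (a + t, b + t) \<otimes> \<alpha> (a + s) [^] t)"
    if s: "a + s < k" for s
  proof -
    have \<alpha>s: "\<alpha> (a + s) \<in> carrier R" using \<alpha>(1) s by (simp add: Pi_iff)
    have idx: "{p \<in> {..u} \<times> {..<w}. fst p + (b + s) = snd p + (a + s)} = (\<lambda>t. (a + t, b + t)) ` {..r}"
    proof (rule Set.set_eqI, rule iffI)
      fix p assume p: "p \<in> {p \<in> {..u} \<times> {..<w}. fst p + (b + s) = snd p + (a + s)}"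
      define t where "t = min (fst p) (snd p)"
      have "p = (a + t, b + t)" "t \<le> r"
        using p ab(3) by (auto simp: t_def r_def min_def prod_eq_iff)
      then show "p \<in> (\<lambda>t. (a + t, b + t)) ` {..r}" by auto
    next
      fix p assume "p \<in> (\<lambda>t. (a + t, b + t)) ` {..r}"
      then show "p \<in> {p \<in> {..u} \<times> {..<w}. fst p + (b + s) = snd p + (a + s)}"
        using ab(5,6) by auto
    qed
    have cl: "(\<lambda>p. h p \<otimes> \<alpha> (a + s) [^] min (fst p) (snd p)) \<in> (\<lambda>t. (a + t, b + t)) ` {..r} \<rightarrow> carrier R"
      unfolding idx[symmetric] using h \<alpha>s by (auto simp: Pi_iff)
    have diag_min: "min (fst (a + t, b + t)) (snd (a + t, b + t)) = t" for t
      using ab(3) by auto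
    have "?D (a + s, b + s)
        = (\<Oplus>t\<in>{..r}. h (a + t, b + t) \<otimes> \<alpha> (a + s) [^] min (fst (a + t, b + t)) (snd (a + t, b + t)))"
      unfolding diagonal_matrix_def split idx
      by (rule finsum_reindex[OF cl]) (simp add: inj_on_def)
    also have "\<dots> = (\<Oplus>t\<in>{..r}. h (a + t, b + t) \<otimes> \<alpha> (a + s) [^] t)"
      by (simp only: diag_min)
    finally show ?thesis .
  qed
  define Z where "Z = {s. s < r + (k - u) \<and> ?D (a + s, b + s) = \<zero>}"
  define N where "N = {s. s < r + (k - u) \<and> ?D (a + s, b + s) \<noteq> \<zero>}"
  have bound: "a + s < k" "b + s < m" if "s < r + (k - u)" for s
    using that ab(5,6) uk w by linarith+
  have "card Z \<le> card {x \<in> carrier R. (\<Oplus>t\<in>{..r}. h (a + t, b + t) \<otimes> x [^] t) = \<zero>}"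
  proof (rule card_inj_on_le)
    show "inj_on (\<lambda>s. \<alpha> (a + s)) Z"
    proof (rule inj_onI)
      fix s t assume st: "s \<in> Z" "t \<in> Z" "\<alpha> (a + s) = \<alpha> (a + t)"
      then have "a + s < k" "a + t < k" using bound(1) unfolding Z_def by blast+
      then have "a + s = a + t" using inj_onD[OF \<alpha>(2) st(3)] by simp
      then show "s = t" by simp
    qed
    show "(\<lambda>s. \<alpha> (a + s)) ` Z \<subseteq> {x \<in> carrier R. (\<Oplus>t\<in>{..r}. h (a + t, b + t) \<otimes> x [^] t) = \<zero>}"
    proof (rule image_subsetI, rule CollectI, rule conjI)
      fix s assume s: "s \<in> Z"
      then have "a + s < k" using bound(1) unfolding Z_def by blast
      then show "\<alpha> (a + s) \<in> carrier R" using \<alpha>(1) by (simp add: Pi_iff)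
      show "(\<Oplus>t\<in>{..r}. h (a + t, b + t) \<otimes> \<alpha> (a + s) [^] t) = \<zero>"
        using s on[OF \<open>a + s < k\<close>] by (simp add: Z_def)
    qed
  qed (use fin in simp)
  also have "\<dots> \<le> r"
  proof (rule card_roots_finsum_le[OF fin _ ab(4)])
    show "(\<lambda>t. h (a + t, b + t)) \<in> {..r} \<rightarrow> carrier R"
      using h ab(5,6) by (auto simp: Pi_iff)
    show "h (a + t0, b + t0) \<noteq> \<zero>" using h0 ab(1,2) by simp
  qed
  finally have "card Z \<le> r" .
  moreover have "card Z + card N = r + (k - u)"
  proof -
    have "Z \<union> N = {..<r + (k - u)}" "Z \<inter> N = {}" by (auto simp: Z_def N_def)
    moreover have "finite Z" "finite N" by (simp_all add: Z_def N_def)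
    ultimately show ?thesis by (metis card_Un_disjoint card_lessThan)
  qed
  ultimately have cN: "k - u \<le> card N" by linarith
  show ?thesis
  proof
    show "(\<lambda>s. a + s) ` N \<subseteq> {..<k}" using bound(1) by (auto simp: N_def)
    show "k - u \<le> card ((\<lambda>s. a + s) ` N)" using cN by (simp add: card_image)
    fix x assume x: "x \<in> {..<k} \<rightarrow> carrier R"
      and ker: "\<And>c. c < m \<Longrightarrow> vec_mat R k ?D x c = \<zero>"
      and off: "\<And>i. i \<in> {..<k} - (\<lambda>s. a + s) ` N \<Longrightarrow> x i = \<zero>"
    have Dm: "?D \<in> {..<k} \<times> {..<m} \<rightarrow> carrier R" using Dc by auto
    have "i < k \<longrightarrow> x i = \<zero>" for i
    proof (induction i rule: less_induct)
      case (less i)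
      show ?case
      proof (cases "i \<in> (\<lambda>s. a + s) ` N")
        case True
        then obtain s where s: "s \<in> N" "i = a + s" by blast
        have i: "i < k" and c: "b + s < m" using s bound by (auto simp: N_def)
        have "vec_mat R k ?D x (b + s) = x i \<otimes> ?D (i, b + s)"
        proof (rule vec_mat_eq_single[OF Dm x c i])
          fix j assume j: "j < k" "j \<noteq> i"
          have "x j \<in> carrier R" using x j by (simp add: Pi_iff)
          moreover have "x j = \<zero> \<or> ?D (j, b + s) = \<zero>"
            using less.IH[of j] below[of j "b + s"] j s(2) by (cases "j < i") auto
          ultimately show "x j \<otimes> ?D (j, b + s) = \<zero>" using Dc[OF j(1)] by auto
        qed
        then have "x i \<otimes> ?D (i, b + s) = \<zero>" using ker[OF c] by simp
        moreover have "?D (i, b + s) \<noteq> \<zero>" using s by (simp add: N_def)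
        moreover have "x i \<in> carrier R" using x i by (simp add: Pi_iff)
        ultimately show ?thesis using integral Dc[OF i] by blast
      next
        case False
        then show ?thesis using off by simp
      qed
    qed
    then show "\<forall>i<k. x i = \<zero>" by blast
  qed
qed

text \<open>
  A common word has the same information part \<open>x\<close> in both codes, and \<open>x (A - B) = 0\<close>. By
  \<open>diagonal_matrix_kernel\<close> such an \<open>x\<close> is determined by at most \<open>u\<close> of its coordinates.
\<close>

lemma card_inter_systematic_codes_le:
  fixes k m u w :: nat
  assumes fin: "finite (carrier R)"
    and \<alpha>: "\<alpha> \<in> {..<k} \<rightarrow> carrier R" "inj_on \<alpha> {..<k}"
    and uk: "u < k" and w: "m + u + 1 = k + w"
    and h: "h \<in> {..u} \<times> {..<w} \<rightarrow> carrier R"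
    and nz: "p0 \<in> {..u} \<times> {..<w}" "h p0 \<noteq> \<zero>"
    and A: "A \<in> {..<k} \<times> {..<m} \<rightarrow> carrier R" and B: "B \<in> {..<k} \<times> {..<m} \<rightarrow> carrier R"
    and AB: "\<And>p. p \<in> {..<k} \<times> {..<m} \<Longrightarrow> A p \<ominus> B p = diagonal_matrix R u w \<alpha> h p"
  shows "card (systematic_code R k m A \<inter> systematic_code R k m B) \<le> card (carrier R) ^ u"
proof -
  let ?D = "diagonal_matrix R u w \<alpha> h" and ?X = "{..<k} \<rightarrow>\<^sub>E carrier R"
  let ?w = "systematic_word R k m"
  obtain I where I: "I \<subseteq> {..<k}" "k - u \<le> card I"
    and ker: "\<And>x. \<lbrakk>x \<in> {..<k} \<rightarrow> carrier R; \<And>c. c < m \<Longrightarrow> vec_mat R k ?D x c = \<zero>;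
          \<And>i. i \<in> {..<k} - I \<Longrightarrow> x i = \<zero>\<rbrakk> \<Longrightarrow> \<forall>i<k. x i = \<zero>"
    using diagonal_matrix_kernel[OF fin \<alpha> uk w h nz] by metis
  let ?J = "{..<k} - I"
  define K where "K = {x \<in> ?X. \<forall>c<m. vec_mat R k ?D x c = \<zero>}"
  have X: "x \<in> {..<k} \<rightarrow> carrier R" if "x \<in> ?X" for x using that by auto
  have Dm: "?D \<in> {..<k} \<times> {..<m} \<rightarrow> carrier R"
  proof (rule funcsetI)
    fix p assume p: "p \<in> {..<k} \<times> {..<m}"
    then have "A p \<in> carrier R" "B p \<in> carrier R" using A B by (auto simp: Pi_iff)
    then show "?D p \<in> carrier R" unfolding AB[OF p, symmetric] by simp
  qed
  have sub: "systematic_code R k m A \<inter> systematic_code R k m B \<subseteq> ?w A ` K"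
  proof (rule subsetI)
    fix z assume "z \<in> systematic_code R k m A \<inter> systematic_code R k m B"
    then obtain x y where x: "x \<in> ?X" "z = ?w A x" and y: "y \<in> ?X" "z = ?w B y"
      unfolding systematic_code_def by blast
    have "x = y"
    proof (rule PiE_ext[OF x(1) y(1)])
      fix i assume "i \<in> {..<k}"
      then show "x i = y i"
        using fun_cong[OF x(2), of i] fun_cong[OF y(2), of i] by (simp add: systematic_word_def)
    qed
    have "vec_mat R k ?D x c = \<zero>" if c: "c < m" for c
    proof -
      have "vec_mat R k A x c = vec_mat R k B x c"
        using fun_cong[OF x(2), of "k + c"] fun_cong[OF y(2), of "k + c"] c \<open>x = y\<close>
        by (simp add: systematic_word_def)
      moreover have "vec_mat R k ?D x c = vec_mat R k (\<lambda>p. A p \<ominus> B p) x c"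
        unfolding vec_mat_def
      proof (rule finsum_cong'[OF refl])
        show "(\<lambda>i. x i \<otimes> (A (i, c) \<ominus> B (i, c))) \<in> {..<k} \<rightarrow> carrier R"
          using A B X[OF x(1)] c by (auto simp: Pi_iff)
        fix i assume "i \<in> {..<k}"
        then show "x i \<otimes> ?D (i, c) = x i \<otimes> (A (i, c) \<ominus> B (i, c))"
          using AB[of "(i, c)"] c by simp
      qed
      ultimately show ?thesis
        using vec_mat_mat_minus[OF A B X[OF x(1)] c] vec_mat_closed[OF B X[OF x(1)] c] by simp
    qed
    then show "z \<in> ?w A ` K" using x by (auto simp: K_def)
  qed
  have inj: "inj_on (\<lambda>x. restrict x ?J) K"
  proof (rule inj_onI)
    fix x y assume "x \<in> K" "y \<in> K" and eq: "restrict x ?J = restrict y ?J"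
    then have x: "x \<in> ?X" and y: "y \<in> ?X"
      and x0: "\<And>c. c < m \<Longrightarrow> vec_mat R k ?D x c = \<zero>"
      and y0: "\<And>c. c < m \<Longrightarrow> vec_mat R k ?D y c = \<zero>"
      by (simp_all add: K_def)
    let ?z = "\<lambda>i\<in>{..<k}. x i \<ominus> y i"
    have car: "x i \<in> carrier R" "y i \<in> carrier R" if "i < k" for i
      using X[OF x] X[OF y] that by (simp_all add: Pi_iff)
    have "\<forall>i<k. ?z i = \<zero>"
    proof (rule ker)
      show "?z \<in> {..<k} \<rightarrow> carrier R" using car by (simp add: Pi_iff)
      fix c assume c: "c < m"
      show "vec_mat R k ?D ?z c = \<zero>"
        unfolding vec_mat_minus[OF Dm X[OF x] X[OF y] c] x0[OF c] y0[OF c] by simp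
    next
      fix i assume i: "i \<in> ?J"
      then have "x i = y i" using fun_cong[OF eq, of i] by simp
      then show "?z i = \<zero>" using i car by simp
    qed
    then show "x = y" using car by (intro PiE_ext[OF x y]) simp
  qed
  have finK: "finite K" using fin by (simp add: K_def finite_PiE)
  have "card (systematic_code R k m A \<inter> systematic_code R k m B) \<le> card (?w A ` K)"
    using finK by (intro card_mono[OF _ sub]) simp
  also have "\<dots> \<le> card K" by (rule card_image_le[OF finK])
  also have "\<dots> \<le> card (?J \<rightarrow>\<^sub>E carrier R)"
  proof (rule card_inj_on_le[OF inj])
    show "(\<lambda>x. restrict x ?J) ` K \<subseteq> ?J \<rightarrow>\<^sub>E carrier R" by (auto simp: K_def)
    show "finite (?J \<rightarrow>\<^sub>E carrier R)" using fin by (simp add: finite_PiE)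
  qed
  also have "\<dots> = card (carrier R) ^ (k - card I)"
    using I(1) finite_subset[OF I(1)] by (simp add: card_PiE card_Diff_subset)
  also have "\<dots> \<le> card (carrier R) ^ u"
    unfolding power_card_carrier_le_iff[OF fin] using I(2) uk by linarith
  finally show ?thesis .
qed

end

section \<open>Averaging over translates\<close>

text \<open>
  Double counting of the pairs in \<open>P\<close>: some \<open>x\<close> lies in at most as many of them as an
  element of \<open>X\<close> does on average.
\<close>

lemma exists_card_fibre_le:
  assumes fin: "finite X" "finite Y" and ne: "X \<noteq> {}"
    and N: "\<And>y. y \<in> Y \<Longrightarrow> card {x \<in> X. P x y} \<le> N"
  shows "\<exists>x\<in>X. card X * card {y \<in> Y. P x y} \<le> card Y * N"
proof (rule ccontr)
  assume "\<not> ?thesis"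
  then have "(\<Sum>x\<in>X. card Y * N) < (\<Sum>x\<in>X. card X * card {y \<in> Y. P x y})"
    using fin ne by (intro sum_strict_mono) (auto simp: not_le)
  also have "\<dots> = card X * (\<Sum>x\<in>X. \<Sum>y\<in>Y. if P x y then 1 else 0)"
    using fin by (simp add: sum_distrib_left sum.If_cases Int_def)
  also have "\<dots> = card X * (\<Sum>y\<in>Y. \<Sum>x\<in>X. if P x y then 1 else 0)"
    by (subst sum.swap) simp
  also have "\<dots> = card X * (\<Sum>y\<in>Y. card {x \<in> X. P x y})"
    using fin by (simp add: sum.If_cases Int_def)
  also have "\<dots> \<le> card X * (\<Sum>y\<in>Y. N)"
    by (intro mult_le_mono2 sum_mono N)
  finally show False by simp
qed

text \<open>
  The averaging step, with the explicit error term \<open>k 2\<^sup>n / q\<close> for \<open>n = k + m\<close>. The width \<open>w\<close> of the coefficient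
  matrices is \<open>m - k + u + 1\<close>, written so as to avoid truncated subtraction.
\<close>

lemma (in field) ex_many_mds_codes:
  fixes k m u w :: nat
  assumes fin: "finite (carrier R)" and kq: "k \<le> card (carrier R)"
    and uk: "u < k" and w: "m + u + 1 = k + w"
  shows "\<exists>M \<subseteq> mds_codes R k (k + m).
    (\<forall>C\<in>M. \<forall>D\<in>M. C \<noteq> D \<longrightarrow> code_dim R (k + m) (C \<inter> D) \<le> u) \<and>
    real (card M) \<ge> real (card (carrier R)) ^ ((u + 1) * w) * (1 - real (k * 2 ^ (k + m)) / real (card (carrier R)))"
proof -
  define q where "q = card (carrier R)"
  define Idx where "Idx = {..<k} \<times> {..<m}"
  define Par where "Par = {..u} \<times> {..<w} \<rightarrow>\<^sub>E carrier R"
  define Mats where "Mats = Idx \<rightarrow>\<^sub>E carrier R"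
  have q_pos: "q > 0" using fin by (auto simp: q_def card_gt_0_iff)
  obtain \<alpha> where \<alpha>: "\<alpha> \<in> {..<k} \<rightarrow> carrier R" "inj_on \<alpha> {..<k}"
    using card_le_inj[OF finite_lessThan fin, of k] kq unfolding image_subset_iff_funcset by auto
  let ?D = "diagonal_matrix R u w \<alpha>"
  define \<tau> where "\<tau> B g = (\<lambda>p\<in>Idx. B p \<oplus> ?D g p)" for B g
  have D: "?D g p \<in> carrier R" if "g \<in> Par" "p \<in> Idx" for g p
  proof -
    obtain i c where p: "p = (i, c)" by (cases p)
    then have "\<alpha> i \<in> carrier R" using that(2) \<alpha>(1) by (simp add: Idx_def Pi_iff)
    moreover have "g \<in> {..u} \<times> {..<w} \<rightarrow> carrier R" using that(1) by (auto simp: Par_def)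
    ultimately show ?thesis unfolding p by (intro diagonal_matrix_closed)
  qed
  have Mat: "B p \<in> carrier R" if "B \<in> Mats" "p \<in> Idx" for B p
    using that by (auto simp: Mats_def)
  have \<tau>_Mats: "\<tau> B g \<in> Mats" if "B \<in> Mats" "g \<in> Par" for B g
    unfolding Mats_def \<tau>_def using D[OF that(2)] Mat[OF that(1)] by simp
  have finP: "finite Par" and finM: "finite Mats"
    using fin by (simp_all add: Par_def Mats_def Idx_def finite_PiE)
  have ne: "Mats \<noteq> {}" using zero_closed by (auto simp: Mats_def PiE_eq_empty_iff)
  have cP: "card Par = q ^ ((u + 1) * w)" and cM: "card Mats = q ^ (k * m)"
    by (simp_all add: Par_def Mats_def Idx_def q_def card_PiE card_cartesian_product)
  let ?bad = "{A \<in> Mats. \<not> mds_matrix R k m A}"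
  \<comment> \<open>For fixed \<open>g\<close>, translation by the matrix of \<open>g\<close> is injective,
     so at most as many of the translates are bad as there are bad matrices.\<close>
  have translate: "card {B \<in> Mats. \<not> mds_matrix R k m (\<tau> B g)} \<le> card ?bad" if g: "g \<in> Par" for g
  proof (rule card_inj_on_le)
    show "(\<lambda>B. \<tau> B g) ` {B \<in> Mats. \<not> mds_matrix R k m (\<tau> B g)} \<subseteq> ?bad"
      using \<tau>_Mats[OF _ g] by blast
    show "inj_on (\<lambda>B. \<tau> B g) {B \<in> Mats. \<not> mds_matrix R k m (\<tau> B g)}"
    proof (rule inj_onI)
      fix B B' assume "B \<in> {B \<in> Mats. \<not> mds_matrix R k m (\<tau> B g)}"
        "B' \<in> {B \<in> Mats. \<not> mds_matrix R k m (\<tau> B g)}" and eq: "\<tau> B g = \<tau> B' g"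
      then have B: "B \<in> Mats" "B' \<in> Mats" by auto
      show "B = B'"
      proof (rule PiE_ext[OF B[unfolded Mats_def]])
        fix p assume p: "p \<in> Idx"
        then show "B p = B' p"
          using fun_cong[OF eq, of p] D[OF g p] Mat[OF B(1) p] Mat[OF B(2) p] by (simp add: \<tau>_def)
      qed
    qed
    show "finite ?bad" using finM by simp
  qed
  obtain B where B: "B \<in> Mats"
    and few: "card Mats * card {g \<in> Par. \<not> mds_matrix R k m (\<tau> B g)} \<le> card Par * card ?bad"
    using exists_card_fibre_le[of Mats Par "\<lambda>B g. \<not> mds_matrix R k m (\<tau> B g)", OF finM finP ne translate]
    by blast
  define good where "good = {g \<in> Par. mds_matrix R k m (\<tau> B g)}"
  let ?C = "\<lambda>g. systematic_code R k m (\<tau> B g)"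
  have \<tau>c: "\<tau> B g \<in> {..<k} \<times> {..<m} \<rightarrow> carrier R" if "g \<in> Par" for g
    using \<tau>_Mats[OF B that] by (auto simp: Mats_def Idx_def)
  have inter: "card (?C g \<inter> ?C h) \<le> q ^ u" if g: "g \<in> Par" and h: "h \<in> Par" and "g \<noteq> h" for g h
  proof -
    have g': "g \<in> {..u} \<times> {..<w} \<rightarrow> carrier R" and h': "h \<in> {..u} \<times> {..<w} \<rightarrow> carrier R"
      using g h by (auto simp: Par_def)
    obtain p0 where p0: "p0 \<in> {..u} \<times> {..<w}" "g p0 \<noteq> h p0"
      using PiE_ext[OF g[unfolded Par_def] h[unfolded Par_def]] \<open>g \<noteq> h\<close> by blast
    show ?thesis
      unfolding q_def
    proof (rule card_inter_systematic_codes_le[OF fin \<alpha> uk w _ p0(1) _ \<tau>c[OF g] \<tau>c[OF h]])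
      show "(\<lambda>p. g p \<ominus> h p) \<in> {..u} \<times> {..<w} \<rightarrow> carrier R"
        using g' h' by (auto simp: Pi_iff)
      have "g p0 \<in> carrier R" "h p0 \<in> carrier R" using g' h' p0(1) by (auto simp: Pi_iff)
      then show "g p0 \<ominus> h p0 \<noteq> \<zero>" using p0(2) by simp
      fix p assume "p \<in> {..<k} \<times> {..<m}"
      then have p: "p \<in> Idx" by (simp add: Idx_def)
      obtain i c where ic: "p = (i, c)" by (cases p)
      have "\<alpha> i \<in> carrier R" using p \<alpha>(1) by (simp add: ic Idx_def Pi_iff)
      then have "?D (\<lambda>p. g p \<ominus> h p) p = ?D g p \<ominus> ?D h p"
        unfolding ic by (rule diagonal_matrix_minus[OF g' h'])
      also have "\<dots> = (B p \<oplus> ?D g p) \<ominus> (B p \<oplus> ?D h p)"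
      proof -
        have "a \<ominus> b = (e \<oplus> a) \<ominus> (e \<oplus> b)" if "a \<in> carrier R" "b \<in> carrier R" "e \<in> carrier R" for a b e
          using that by algebra
        then show ?thesis using D[OF g p] D[OF h p] Mat[OF B p] by blast
      qed
      finally show "\<tau> B g p \<ominus> \<tau> B h p = ?D (\<lambda>p. g p \<ominus> h p) p"
        using p by (simp add: \<tau>_def)
    qed
  qed
  \<comment> \<open>Equal codes for distinct parameters would have an intersection of dimension \<open>k > u\<close>.\<close>
  have inj: "inj_on ?C good"
  proof (rule inj_onI, rule ccontr)
    fix g h assume "g \<in> good" "h \<in> good" and eq: "?C g = ?C h" and "g \<noteq> h"
    then have "card (?C g \<inter> ?C g) \<le> q ^ u" using inter[of g h] by (simp add: good_def)
    then have "q ^ k \<le> q ^ u" by (simp add: card_systematic_code q_def)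
    then show False using uk power_card_carrier_le_iff[OF fin] by (simp add: q_def)
  qed
  have mds: "?C ` good \<subseteq> mds_codes R k (k + m)"
  proof (rule image_subsetI)
    fix g assume "g \<in> good"
    then have g: "g \<in> Par" "mds_matrix R k m (\<tau> B g)" by (simp_all add: good_def)
    have "k > 0" using uk by linarith
    then show "?C g \<in> mds_codes R k (k + m)"
      by (rule systematic_code_mds[OF fin _ \<tau>c[OF g(1)] g(2)])
  qed
  have dims: "code_dim R (k + m) (C \<inter> D) \<le> u" 
    if CD: "C \<in> ?C ` good" "D \<in> ?C ` good" "C \<noteq> D" for C D
  proof -
    obtain g h where g: "g \<in> Par" "C = ?C g" and h: "h \<in> Par" "D = ?C h"
      using CD(1,2) unfolding good_def by blast
    interpret V: cring "coord_space R (k + m)" by (rule cring_coord_space) (rule is_cring)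
    have lin: "linear_code R (k + m) (C \<inter> D)"
      using linear_systematic_code[OF \<tau>c[OF g(1)]] linear_systematic_code[OF \<tau>c[OF h(1)]]
      unfolding linear_code_def g(2) h(2) by (rule V.subalgebra_inter)
    then have "q ^ code_dim R (k + m) (C \<inter> D) = card (C \<inter> D)"
      using card_linear_code[OF field_axioms fin _ lin] uk by (simp add: q_def)
    also have "\<dots> \<le> q ^ u" using inter[OF g(1) h(1)] CD(3) unfolding g(2) h(2) by blast
    finally show ?thesis unfolding q_def power_card_carrier_le_iff[OF fin] .
  qed
  let ?b = "card {g \<in> Par. \<not> mds_matrix R k m (\<tau> B g)}"
  define K where "K = k * 2 ^ (k + m)"
  have "q * (card Mats * ?b) \<le> q * (card Par * card ?bad)" by (rule mult_le_mono2[OF few])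
  also have "\<dots> = card Par * (q * card ?bad)" by simp
  also have "\<dots> \<le> card Par * (K * card Mats)"
    using card_not_mds_matrix[OF fin, of k m] unfolding cM K_def
    by (intro mult_le_mono2) (simp add: q_def Mats_def Idx_def)
  finally have "card Mats * (q * ?b) \<le> card Mats * (card Par * K)" by (simp add: mult_ac)
  moreover have "card Mats > 0" using finM ne by (simp add: card_gt_0_iff)
  ultimately have qb: "q * ?b \<le> card Par * K" by simp
  have "card good + ?b = card Par"
  proof -
    have "good \<union> {g \<in> Par. \<not> mds_matrix R k m (\<tau> B g)} = Par"
      "good \<inter> {g \<in> Par. \<not> mds_matrix R k m (\<tau> B g)} = {}" by (auto simp: good_def)
    then show ?thesis using finP by (metis card_Un_disjoint finite_Un)
  qed
  then have "real (card good) = real (card Par) - real ?b" by linarith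
  moreover have "real ?b \<le> real (card Par) * real K / real q"
    using of_nat_mono[OF qb, where 'a = real] q_pos by (simp add: field_simps)
  ultimately have "real (card Par) * (1 - real K / real q) \<le> real (card (?C ` good))"
    by (simp add: card_image[OF inj] right_diff_distrib)
  then have size: "real (card (?C ` good)) \<ge> real q ^ ((u + 1) * w) * (1 - real K / real q)"
    by (simp add: cP)
  show ?thesis
    unfolding q_def[symmetric] K_def[symmetric]
    by (rule exI[of _ "?C ` good"], intro conjI ballI impI mds dims size)
qed

theorem proposition3p20:
  fixes k n u :: nat
  assumes "k \<ge> 2" and "n \<ge> 2 * k - 1" and "u \<le> k - 2"
  shows "\<exists>\<epsilon> :: nat \<Rightarrow> real.
    (\<epsilon> \<longlongrightarrow> 0) (inf at_top (principal {q. primepow q})) \<and>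
    (\<forall>q \<ge> n. primepow q \<longrightarrow>
      (\<forall>F :: 'a ring. field F \<and> finite (carrier F) \<and> card (carrier F) = q \<longrightarrow>
        (\<exists>M \<subseteq> mds_codes F k n.
          (\<forall>C \<in> M. \<forall>D \<in> M. C \<noteq> D \<longrightarrow> code_dim F n (C \<inter> D) \<le> u) \<and>
          real (card M) \<ge> real q ^ ((u + 1) * (n + u + 1 - 2 * k)) * (1 + \<epsilon> q))))"
proof (rule exI[of _ "\<lambda>q. - (real (k * 2 ^ n) / real q)"], intro conjI allI impI)
  let ?\<epsilon> = "\<lambda>q. - (real (k * 2 ^ n) / real q)"
  have "(?\<epsilon> \<longlongrightarrow> - 0) at_top"
    by (intro tendsto_minus lim_const_over_n)
  then show "(?\<epsilon> \<longlongrightarrow> 0) (inf at_top (principal {q. primepow q}))"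
    by (auto intro: tendsto_mono[OF inf_le1])
  fix q :: nat and F :: "'a ring"
  assume q: "n \<le> q" and F: "field F \<and> finite (carrier F) \<and> card (carrier F) = q"
  interpret F: field F using F by simp
  have n: "k + (n - k) = n" using assms by linarith
  have "\<exists>M \<subseteq> mds_codes F k (k + (n - k)).
    (\<forall>C\<in>M. \<forall>D\<in>M. C \<noteq> D \<longrightarrow> code_dim F (k + (n - k)) (C \<inter> D) \<le> u) \<and>
    real (card M) \<ge> real (card (carrier F)) ^ ((u + 1) * (n + u + 1 - 2 * k))
      * (1 - real (k * 2 ^ (k + (n - k))) / real (card (carrier F)))"
    using F q assms by (intro F.ex_many_mds_codes) linarith+
  then show "\<exists>M \<subseteq> mds_codes F k n.
      (\<forall>C \<in> M. \<forall>D \<in> M. C \<noteq> D \<longrightarrow> code_dim F n (C \<inter> D) \<le> u) \<and>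
      real (card M) \<ge> real q ^ ((u + 1) * (n + u + 1 - 2 * k)) * (1 + ?\<epsilon> q)"
    using F unfolding n by simp
qed

end
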